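(* Let $\Gamma$ be a countable group, $P$ a probability measure on $\Gamma$, $(\mu_n)$ a sequence of elements of $\mathcal{C}$ which is approximately $P$-invariant, and $m$ a (weak$^*$) accumulation point of $(\mu_n)$. Then $\pi:f\mapsto f*m$ is a norm $1$ projection from $\ell^\infty(\Gamma)$ to the space $\mathsf{B}\mathcal{H}_P(\Gamma)$ of bounded $P$-harmonic functions. Furthermore, writing $I$ for the identity operator of $\ell^\infty(\Gamma)$ and $P$ also for the operator $f\mapsto f*P$ on $\ell^\infty(\Gamma)$: - $\ker(I-\pi)=\operatorname{Im}\pi=\ker(I-P)$; - $\operatorname{Im}(I-P)\subsetneq\ker\pi=\operatorname{Im}(I-\pi)$; - if the subgroup $\langle\operatorname{supp}P\rangle$ generated by the support of $P$ is infinite, then $c_0(\Gamma)\subset\ker\pi$ and hence $\ker P\subsetneq\ker\pi$.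
   Context: For $f\in\ell^\infty(\Gamma)$ and $g\in\ell^1(\Gamma)$, $(f*g)(\gamma)=\sum_{y\in\Gamma} f(\gamma y^{-1})g(y)$. $\delta_e$ is the Dirac mass at the identity and $P^n$ denotes the $n$-fold convolution power of $P$, with $P^0=\delta_e$. A function $f$ is $P$-harmonic if $f*P=f$, and $\mathsf{B}\mathcal{H}_P(\Gamma)=\{f\in\ell^\infty(\Gamma): f*P=f\}$. $\mathcal{C}=\{\sum_{i\ge0}a_iP^i : a_i\ge0,\ \sum_i a_i=1\}$. A sequence of probability measures $\mu_n$ is approximately $P$-invariant if $\|\mu_n*(\delta_e-P)\|_{\ell^1}\to0$. Probability measures are regarded as elements of $(\ell^\infty(\Gamma))^*$ via $\langle f\mid\mu\rangle=\sum_\gamma f(\gamma)\mu(\gamma)$; weak$^*$ accumulation points of sequences of probability measures are means on $\Gamma$, i.e. elements $m$ of $(\ell^\infty(\Gamma))^*$ with $m(\mathbf{1})=1$ (where $\mathbf{1}$ is the constant function $1$) and $m(f)\ge0$ whenever $f\ge0$. For a mean $m$ and $f\in\ell^\infty(\Gamma)$, $f*m\in\ell^\infty(\Gamma)$ is defined by letting $(f*m)(\gamma)$ be the value of $m$ on the bounded function $y\mapsto f(\gamma y^{-1})$. $c_0(\Gamma)$ is the norm closure in $\ell^\infty(\Gamma)$ of the finitely supported functions.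
   Formalization: The strictness of Im(I−P) ⊊ ker π is claimed only when ⟨supp P⟩ is infinite; in general only Im(I−P) ⊆ ker π is stated. As printed it fails for P = δ_e (both sides are {0}), and whenever ⟨supp P⟩ is finite the two spaces are equal. *)

theory Defs
  imports "HOL-Probability.Probability"
begin

text \<open>
  A countable discrete group is a type of sort
  \<open>{group_add, countable, discrete_topology}\<close>. The class \<open>group_add\<close> is not commutative; it
  only writes the group law additively, so \<open>\<gamma> y\<^sup>-\<^sup>1\<close> is \<open>\<gamma> - y\<close> and the identity is \<open>0\<close>.

  Every function on a discrete space is continuous, so the Banach space of bounded functions with
  the supremum norm is the type \<open>'g \<Rightarrow>\<^sub>C 'k\<close>. The sort \<open>{real_normed_field, banach}\<close> of the scalars
  covers both the real and the complex numbers (and, by the theorem of Gelfand and Mazur, nothing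
  else up to isomorphism).
\<close>

lemma bcontfun_discrete_iff:
  fixes f :: "'g::discrete_topology \<Rightarrow> 'k::metric_space"
  shows "f \<in> bcontfun \<longleftrightarrow> bounded (range f)"
  by (simp add: bcontfun_def)

definition is_subgroup :: "'g::group_add set \<Rightarrow> bool" where
  "is_subgroup H \<longleftrightarrow> 0 \<in> H \<and> (\<forall>x\<in>H. \<forall>y\<in>H. x + y \<in> H) \<and> (\<forall>x\<in>H. - x \<in> H)"

definition generated_subgroup :: "'g::group_add set \<Rightarrow> 'g set" where
  "generated_subgroup S = is_subgroup hull S"

definition conv :: "('g::group_add \<Rightarrow> 'k::real_normed_vector) \<Rightarrow> ('g \<Rightarrow> real) \<Rightarrow> 'g \<Rightarrow> 'k" where
  "conv f g \<gamma> = (\<Sum>\<^sub>\<infinity>y. g y *\<^sub>R f (\<gamma> - y))"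

definition dirac :: "'g::group_add \<Rightarrow> real" where
  "dirac = indicator {0}"

primrec conv_power :: "('g::group_add \<Rightarrow> real) \<Rightarrow> nat \<Rightarrow> 'g \<Rightarrow> real" where
  "conv_power p 0 = dirac"
| "conv_power p (Suc n) = conv (conv_power p n) p"

definition convex_powers :: "'g::group_add pmf \<Rightarrow> ('g \<Rightarrow> real) set" where
  "convex_powers P =
    {\<lambda>\<gamma>. \<Sum>\<^sub>\<infinity>i. a i * conv_power (pmf P) i \<gamma> | a. (\<forall>i. 0 \<le> a i) \<and> (a has_sum 1) UNIV}"

text \<open>The sum below is the \<open>\<ell>\<^sup>1\<close> norm whenever the \<open>\<mu> n\<close> are in \<open>\<ell>\<^sup>1\<close>, as the elements of
  \<^const>\<open>convex_powers\<close> are.\<close>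

definition approx_invariant :: "'g::group_add pmf \<Rightarrow> (nat \<Rightarrow> 'g \<Rightarrow> real) \<Rightarrow> bool" where
  "approx_invariant P \<mu> \<longleftrightarrow>
    (\<lambda>n. \<Sum>\<^sub>\<infinity>\<gamma>. \<bar>conv (\<mu> n) (\<lambda>y. dirac y - pmf P y) \<gamma>\<bar>) \<longlonglongrightarrow> 0"

definition measure_functional ::
    "('g::discrete_topology \<Rightarrow> real) \<Rightarrow> ('g \<Rightarrow>\<^sub>C 'k::{real_normed_field, banach}) \<Rightarrow>\<^sub>L 'k" where
  "measure_functional \<mu> = Blinfun (\<lambda>f. \<Sum>\<^sub>\<infinity>\<gamma>. \<mu> \<gamma> *\<^sub>R apply_bcontfun f \<gamma>)"

lemma abs_summable_scaleR_bounded: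
  fixes f :: "'g \<Rightarrow> 'k::{real_normed_vector, banach}"
  assumes "\<mu> summable_on UNIV" "\<And>x. norm (f x) \<le> B"
  shows "(\<lambda>x. norm (\<mu> x *\<^sub>R f x)) summable_on UNIV"
    and "norm (\<Sum>\<^sub>\<infinity>x. \<mu> x *\<^sub>R f x) \<le> (\<Sum>\<^sub>\<infinity>x. \<bar>\<mu> x\<bar>) * B"
proof -
  have abs: "(\<lambda>x. \<bar>\<mu> x\<bar>) summable_on UNIV"
    using summable_on_iff_abs_summable_on_real[THEN iffD1, OF assms(1)] by simp
  then have absB: "(\<lambda>x. \<bar>\<mu> x\<bar> * B) summable_on UNIV"
    by (rule summable_on_cmult_left)
  have le: "norm (\<mu> x *\<^sub>R f x) \<le> \<bar>\<mu> x\<bar> * B" for x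
    using assms(2)[of x] by (simp add: mult_left_mono)
  show *: "(\<lambda>x. norm (\<mu> x *\<^sub>R f x)) summable_on UNIV"
    using absB le by (rule Infinite_Sum.abs_summable_on_comparison_test')
  have "norm (\<Sum>\<^sub>\<infinity>x. \<mu> x *\<^sub>R f x) \<le> (\<Sum>\<^sub>\<infinity>x. norm (\<mu> x *\<^sub>R f x))"
    using * by (rule norm_infsum_bound)
  also have "\<dots> \<le> (\<Sum>\<^sub>\<infinity>x. \<bar>\<mu> x\<bar> * B)"
    using * absB le by (rule infsum_mono)
  also have "\<dots> = (\<Sum>\<^sub>\<infinity>x. \<bar>\<mu> x\<bar>) * B"
    by (rule infsum_cmult_left) (use abs in blast)
  finally show "norm (\<Sum>\<^sub>\<infinity>x. \<mu> x *\<^sub>R f x) \<le> (\<Sum>\<^sub>\<infinity>x. \<bar>\<mu> x\<bar>) * B" .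
qed

lemma measure_functional_apply:
  fixes f :: "'g::discrete_topology \<Rightarrow>\<^sub>C 'k::{real_normed_field, banach}"
  assumes "\<mu> summable_on UNIV"
  shows "measure_functional \<mu> f = (\<Sum>\<^sub>\<infinity>\<gamma>. \<mu> \<gamma> *\<^sub>R f \<gamma>)"
proof -
  have summ: "(\<lambda>\<gamma>. \<mu> \<gamma> *\<^sub>R apply_bcontfun h \<gamma>) summable_on UNIV" for h :: "'g \<Rightarrow>\<^sub>C 'k"
    by (rule abs_summable_summable, rule abs_summable_scaleR_bounded(1)[OF assms norm_bounded])
  have "bounded_linear (\<lambda>h::'g \<Rightarrow>\<^sub>C 'k. \<Sum>\<^sub>\<infinity>\<gamma>. \<mu> \<gamma> *\<^sub>R h \<gamma>)"
  proof (rule bounded_linear_intro)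
    fix h k :: "'g \<Rightarrow>\<^sub>C 'k" and r :: real
    show "(\<Sum>\<^sub>\<infinity>\<gamma>. \<mu> \<gamma> *\<^sub>R (h + k) \<gamma>) = (\<Sum>\<^sub>\<infinity>\<gamma>. \<mu> \<gamma> *\<^sub>R h \<gamma>) + (\<Sum>\<^sub>\<infinity>\<gamma>. \<mu> \<gamma> *\<^sub>R k \<gamma>)"
      using infsum_add[OF summ[of h] summ[of k]] by (simp add: scaleR_add_right)
    show "(\<Sum>\<^sub>\<infinity>\<gamma>. \<mu> \<gamma> *\<^sub>R (r *\<^sub>R h) \<gamma>) = r *\<^sub>R (\<Sum>\<^sub>\<infinity>\<gamma>. \<mu> \<gamma> *\<^sub>R h \<gamma>)"
      using infsum_scaleR_right[of r "\<lambda>\<gamma>. \<mu> \<gamma> *\<^sub>R h \<gamma>" UNIV]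
      by (simp add: mult.commute)
    show "norm (\<Sum>\<^sub>\<infinity>\<gamma>. \<mu> \<gamma> *\<^sub>R h \<gamma>) \<le> norm h * (\<Sum>\<^sub>\<infinity>\<gamma>. \<bar>\<mu> \<gamma>\<bar>)"
      using abs_summable_scaleR_bounded(2)[OF assms norm_bounded, of h] by (simp add: mult.commute)
  qed
  then show ?thesis
    by (simp add: measure_functional_def bounded_linear_Blinfun_apply)
qed

text \<open>
  On functionals, \<^const>\<open>strong_operator_topology\<close> is the topology of pointwise convergence on
  \<open>\<ell>\<^sup>\<infinity>\<close>, that is, the weak* topology. An accumulation point of the sequence is a functional each
  of whose neighbourhoods contains infinitely many terms. For complex scalars the type of \<open>m\<close> asks
  only for real linearity; complex linearity of \<open>m\<close>, like its being a mean, is inherited from the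
  \<open>\<mu> n\<close>.
\<close>

definition weak_star_accumulation_point ::
    "(('g::discrete_topology \<Rightarrow>\<^sub>C 'k::{real_normed_field, banach}) \<Rightarrow>\<^sub>L 'k)
      \<Rightarrow> (nat \<Rightarrow> 'g \<Rightarrow> real) \<Rightarrow> bool" where
  "weak_star_accumulation_point m \<mu> \<longleftrightarrow>
    (\<forall>U. openin strong_operator_topology U \<and> m \<in> U
      \<longrightarrow> (\<exists>\<^sub>F n in sequentially. measure_functional (\<mu> n) \<in> U))"

definition conv_mean ::
    "(('g::{group_add, discrete_topology} \<Rightarrow>\<^sub>C 'k::real_normed_field) \<Rightarrow>\<^sub>L 'k)
      \<Rightarrow> ('g \<Rightarrow>\<^sub>C 'k) \<Rightarrow> ('g \<Rightarrow>\<^sub>C 'k)" where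
  "conv_mean m f = Bcontfun (\<lambda>\<gamma>. blinfun_apply m (Bcontfun (\<lambda>y. apply_bcontfun f (\<gamma> - y))))"

lemma conv_mean_apply:
  fixes f :: "'g::{group_add, discrete_topology} \<Rightarrow>\<^sub>C 'k::real_normed_field"
  shows "apply_bcontfun (Bcontfun (\<lambda>y. f (\<gamma> - y))) z = f (\<gamma> - z)"
    and "conv_mean m f \<gamma> = m (Bcontfun (\<lambda>y. f (\<gamma> - y)))"
proof -
  have mem: "(\<lambda>y. f (\<gamma> - y)) \<in> bcontfun" for \<gamma>
    unfolding bcontfun_discrete_iff by (rule boundedI[of _ "norm f"]) (auto intro: norm_bounded)
  then show "apply_bcontfun (Bcontfun (\<lambda>y. f (\<gamma> - y))) z = f (\<gamma> - z)"
    by (simp add: Bcontfun_inverse)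
  have nle: "norm (Bcontfun (\<lambda>y. f (\<gamma> - y))) \<le> norm f" for \<gamma>
    by (rule norm_bound) (simp add: Bcontfun_inverse mem norm_bounded)
  have "norm (m (Bcontfun (\<lambda>y. f (\<gamma> - y)))) \<le> norm m * norm f" for \<gamma>
    by (rule order_trans[OF norm_blinfun]) (simp add: mult_left_mono nle)
  then have "(\<lambda>\<gamma>. m (Bcontfun (\<lambda>y. f (\<gamma> - y)))) \<in> bcontfun"
    unfolding bcontfun_discrete_iff by (intro boundedI[of _ "norm m * norm f"]) auto
  then show "conv_mean m f \<gamma> = m (Bcontfun (\<lambda>y. f (\<gamma> - y)))"
    by (simp add: conv_mean_def Bcontfun_inverse)
qed

definition conv_op ::
    "'g::{group_add, discrete_topology} pmf
      \<Rightarrow> ('g \<Rightarrow>\<^sub>C 'k::{real_normed_field, banach}) \<Rightarrow> ('g \<Rightarrow>\<^sub>C 'k)" where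
  "conv_op P f = Bcontfun (conv (apply_bcontfun f) (pmf P))"

lemma pmf_summable_on: "pmf P summable_on UNIV"
  using pmf_abs_summable[of P UNIV] abs_summable_equivalent abs_summable_summable by blast

lemma conv_op_apply: "apply_bcontfun (conv_op P f) = conv f (pmf P)"
proof -
  have "norm (conv f (pmf P) \<gamma>) \<le> (\<Sum>\<^sub>\<infinity>y. \<bar>pmf P y\<bar>) * norm f" for \<gamma>
    unfolding conv_def by (rule abs_summable_scaleR_bounded(2)[OF pmf_summable_on norm_bounded])
  then have "conv f (pmf P) \<in> bcontfun"
    unfolding bcontfun_discrete_iff by (intro boundedI) auto
  then show ?thesis
    by (simp add: conv_op_def Bcontfun_inverse)
qed

definition bounded_harmonic ::
    "'g::{group_add, discrete_topology} pmf \<Rightarrow> ('g \<Rightarrow>\<^sub>C 'k::{real_normed_field, banach}) set" where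
  "bounded_harmonic P = {f. conv (apply_bcontfun f) (pmf P) = apply_bcontfun f}"

definition c0 :: "('g::discrete_topology \<Rightarrow>\<^sub>C 'k::real_normed_field) set" where
  "c0 = closure {f. finite {\<gamma>. apply_bcontfun f \<gamma> \<noteq> 0}}"

definition ker :: "('a \<Rightarrow> 'b::zero) \<Rightarrow> 'a set" where
  "ker T = {x. T x = 0}"

text \<open>The library's \<^const>\<open>bounded_linear\<close> is linearity over the reals; the following scalar
  multiplication serves to express linearity over the field \<open>'k\<close>.\<close>

definition scalar_mult :: "'k::real_normed_field \<Rightarrow> ('g::discrete_topology \<Rightarrow>\<^sub>C 'k) \<Rightarrow> ('g \<Rightarrow>\<^sub>C 'k)" where
  "scalar_mult c f = Bcontfun (\<lambda>\<gamma>. c * apply_bcontfun f \<gamma>)"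

lemma scalar_mult_apply: "scalar_mult c f \<gamma> = c * f \<gamma>"
proof -
  have "(\<lambda>\<gamma>. c * f \<gamma>) \<in> bcontfun"
    unfolding bcontfun_discrete_iff
    by (rule boundedI[of _ "norm c * norm f"])
      (auto simp: norm_mult intro!: mult_left_mono norm_bounded)
  then show ?thesis
    by (simp add: scalar_mult_def Bcontfun_inverse)
qed

end

theory Submission
  imports Defs
begin

text \<open>
  The elements of \<^const>\<open>convex_powers\<close> are the laws of a random walk with step distribution \<open>P\<close>,
  stopped at an independent random time. Three properties of such measures pass to the weak*
  accumulation point \<open>m\<close>. They are means of norm at most one. They commute with \<open>P\<close>, so that their
  asymptotic invariance makes \<open>m\<close> invariant under convolution by \<open>P\<close> on either side. They reproduce
  \<open>P\<close>-harmonic functions. The locale \<open>stationary_mean\<close> collects these properties, and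
  \<open>stationary_mean_of_accumulation_point\<close> derives them.

  Invariance on one side makes \<open>f * m\<close> harmonic, once \<open>m\<close> is exchanged with the infinite convex
  combination given by \<open>P\<close> (\<open>blinfun_avg\<close>). Invariance on the other side gives
  \<open>(f * P) * m = f * m\<close>. Since harmonic functions are fixed, \<open>\<pi>\<close> is a projection onto them, its
  kernel is the image of \<open>I - \<pi>\<close>, and this kernel contains the image of \<open>I - P\<close>.

  Suppose that the support of \<open>P\<close> generates an infinite subgroup. The function
  \<open>\<gamma> \<mapsto> m(\<delta>\<^sub>\<gamma>)\<close> is harmonic, because it is \<open>\<delta>\<^sub>e * m\<close>, and its absolute values have sum at most one. If
  it were nonzero, its modulus would attain its maximum on a finite nonempty set, and by the maximum
  principle this set would be stable under the whole subgroup. Hence \<open>m\<close> vanishes on point masses, and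
  therefore \<open>\<pi>\<close> vanishes on \<open>c\<^sub>0\<close> (\<open>c0_subset_ker_conv_mean\<close>).

  Finally \<open>c\<^sub>0\<close> is never contained in the image of \<open>I - P\<close> (\<open>c0_not_subset_coboundaries\<close>). The sums
  \<open>f * P\<^sup>0 + \<dots> + f * P\<^sup>n\<^sup>-\<^sup>1\<close> telescope for \<open>f = g - g * P\<close> and stay bounded by \<open>2 \<parallel>g\<parallel>\<close>. But
  \<open>P\<^sup>0 + \<dots> + P\<^sup>n\<^sup>-\<^sup>1\<close> is a positive measure of mass \<open>n\<close>, and a nonnegative function that decays slowly
  enough at infinity makes these sums unbounded. This separates the image of \<open>I - P\<close> from the kernel
  of \<open>\<pi>\<close>; the function \<open>\<delta>\<^sub>e\<close> separates the kernel of \<open>P\<close> from it, as \<open>\<delta>\<^sub>e * P = P \<noteq> 0\<close>.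
\<close>

section \<open>Averages against a probability mass function\<close>

lemma
  fixes f g :: "'a \<Rightarrow> 'b::real_normed_vector"
  assumes "f summable_on A" "g summable_on A"
  shows summable_on_diff: "(\<lambda>x. f x - g x) summable_on A"
    and infsum_diff: "(\<Sum>\<^sub>\<infinity>x\<in>A. f x - g x) = infsum f A - infsum g A"
proof -
  have "((\<lambda>x. f x + - g x) has_sum (infsum f A + - infsum g A)) A"
    using assms by (intro has_sum_add has_sum_uminus[THEN iffD2]) auto
  then show "(\<lambda>x. f x - g x) summable_on A"
      "(\<Sum>\<^sub>\<infinity>x\<in>A. f x - g x) = infsum f A - infsum g A"
    using infsumI has_sum_imp_summable by fastforce+
qed

lemma has_sum_restrict_finite:
  fixes a :: "'a \<Rightarrow> 'b::{comm_monoid_add, topological_space}"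
  assumes "finite F"
  shows "((\<lambda>y. if y \<in> F then a y else 0) has_sum sum a F) UNIV"
proof -
  have "((\<lambda>y. if y \<in> F then a y else 0) has_sum sum a F) UNIV \<longleftrightarrow> (a has_sum sum a F) F"
    by (rule has_sum_cong_neutral) auto
  then show ?thesis using assms by simp
qed

text \<open>
  The scalars form an arbitrary complete normed field, which need not be second countable; hence an
  unconditional sum takes the place of the Bochner integral.
\<close>

definition avg :: "'a pmf \<Rightarrow> ('a \<Rightarrow> 'k::{real_normed_vector, banach}) \<Rightarrow> 'k" where
  "avg M f = (\<Sum>\<^sub>\<infinity>y. pmf M y *\<^sub>R f y)"

lemma has_sum_pmf: "(pmf M has_sum 1) UNIV"
proof -
  have "infsum (pmf M) UNIV = infsetsum (pmf M) UNIV"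
    by (rule infsetsum_infsum[OF pmf_abs_summable, symmetric])
  also have "\<dots> = 1"
    by (rule infsetsum_pmf_eq_1) (rule subset_UNIV)
  finally show ?thesis
    using has_sum_infsum[OF pmf_summable_on[of M]] by simp
qed

lemma infsum_pmf: "(\<Sum>\<^sub>\<infinity>y. pmf M y) = 1"
  using has_sum_pmf by (rule infsumI)

lemma avg_summable:
  fixes f :: "'a \<Rightarrow> 'k::{real_normed_vector, banach}"
  assumes "\<And>x. norm (f x) \<le> B"
  shows "(\<lambda>y. pmf M y *\<^sub>R f y) summable_on UNIV"
  by (rule abs_summable_summable, rule abs_summable_scaleR_bounded(1)[OF pmf_summable_on assms])

lemma norm_avg_le:
  fixes f :: "'a \<Rightarrow> 'k::{real_normed_vector, banach}"
  assumes "\<And>x. norm (f x) \<le> B"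
  shows "norm (avg M f) \<le> B"
  using abs_summable_scaleR_bounded(2)[OF pmf_summable_on[of M] assms]
  by (simp add: avg_def infsum_pmf)

lemma avg_const: "avg M (\<lambda>_. c) = c"
  using infsum_scaleR_left[OF pmf_summable_on[of M], of c] by (simp add: avg_def infsum_pmf)

lemma avg_add:
  assumes "\<And>x. norm (f x) \<le> B" "\<And>x. norm (g x) \<le> C"
  shows "avg M (\<lambda>y. f y + g y) = avg M f + avg M g"
  unfolding avg_def scaleR_add_right using assms by (intro infsum_add avg_summable)

lemma avg_diff:
  assumes "\<And>x. norm (f x) \<le> B" "\<And>x. norm (g x) \<le> C"
  shows "avg M (\<lambda>y. f y - g y) = avg M f - avg M g"
  using avg_add[of f B "\<lambda>x. - g x" C M] assms
  by (simp add: avg_def infsum_uminus)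

lemma avg_of_real:
  assumes "\<And>x. norm (f x) \<le> B"
  shows "avg M (\<lambda>y. of_real (f y) :: 'k::{real_normed_field, banach}) = of_real (avg M f)"
proof -
  have "((\<lambda>y. of_real (pmf M y *\<^sub>R f y) :: 'k) has_sum of_real (avg M f)) UNIV"
    unfolding avg_def
    by (intro has_sum_of_real has_sum_infsum avg_summable[of f, OF assms])
  then show ?thesis
    by (auto simp: avg_def scaleR_conv_of_real dest!: infsumI)
qed

lemma avg_return: "avg (return_pmf a) f = f a"
proof -
  have "avg (return_pmf a) f = (\<Sum>\<^sub>\<infinity>y\<in>{a}. pmf (return_pmf a) y *\<^sub>R f y)"
    unfolding avg_def by (rule infsum_cong_neutral) auto
  then show ?thesis by simp
qed

lemma pmf_bind_avg: "pmf (bind_pmf A K) x = avg A (\<lambda>i. pmf (K i) x)"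
proof -
  have "Infinite_Set_Sum.abs_summable_on (\<lambda>i. pmf A i * pmf (K i) x) UNIV"
    using abs_summable_scaleR_bounded(1)[OF pmf_summable_on[of A], of "\<lambda>i. pmf (K i) x" 1]
    by (simp add: pmf_le_1 abs_summable_equivalent[symmetric])
  then show ?thesis
    by (simp add: pmf_bind pmf_expectation_eq_infsetsum avg_def infsetsum_infsum)
qed

text \<open>
  Fubini's theorem: the double family is absolutely summable because \<open>f\<close> is bounded and the weights
  have total mass one.
\<close>

lemma avg_bind:
  fixes f :: "'a \<Rightarrow> 'k::{real_normed_vector, banach}"
  assumes B: "\<And>x. norm (f x) \<le> B"
  shows "avg (bind_pmf A K) f = avg A (\<lambda>i. avg (K i) f)"
proof -
  let ?F = "\<lambda>(i, x). (pmf A i * pmf (K i) x) *\<^sub>R f x"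
  have "(\<lambda>ix. norm (?F ix)) summable_on UNIV \<times> UNIV"
  proof (rule Infinite_Sum.abs_summable_on_Sigma_iff[THEN iffD2], intro conjI ballI)
    fix i
    have "(\<lambda>x. norm (pmf (K i) x *\<^sub>R f x)) summable_on UNIV"
      by (rule abs_summable_scaleR_bounded(1)[OF pmf_summable_on B])
    from summable_on_cmult_right[OF this, of "pmf A i"]
    show "(\<lambda>x. norm (?F (i, x))) summable_on UNIV"
      by (simp add: mult.assoc)
  next
    have "(\<Sum>\<^sub>\<infinity>x. norm (?F (i, x))) = pmf A i *\<^sub>R avg (K i) (\<lambda>x. norm (f x))" for i
      by (simp add: mult.assoc avg_def infsum_cmult_right')
    moreover have "norm (avg (K i) (\<lambda>x. norm (f x))) \<le> B" for i
      using B by (intro norm_avg_le) auto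
    ultimately show "(\<lambda>i. norm (\<Sum>\<^sub>\<infinity>x. norm (?F (i, x)))) summable_on UNIV"
      using abs_summable_scaleR_bounded(1)[OF pmf_summable_on[of A], of "\<lambda>i. avg (K i) (\<lambda>x. norm (f x))" B]
      by simp
  qed
  then have swap: "(\<Sum>\<^sub>\<infinity>i. \<Sum>\<^sub>\<infinity>x. ?F (i, x)) = (\<Sum>\<^sub>\<infinity>x. \<Sum>\<^sub>\<infinity>i. ?F (i, x))"
    using infsum_swap_banach[of "\<lambda>i x. ?F (i, x)" UNIV UNIV] abs_summable_summable by auto
  have s: "(\<lambda>i. pmf A i * pmf (K i) x) summable_on UNIV" for x
    using avg_summable[of "\<lambda>i. pmf (K i) x" 1 A] by (simp add: pmf_le_1)
  have "avg (bind_pmf A K) f = (\<Sum>\<^sub>\<infinity>x. \<Sum>\<^sub>\<infinity>i. ?F (i, x))"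
    unfolding avg_def pmf_bind_avg using s by (simp add: infsum_scaleR_left)
  also have "\<dots> = avg A (\<lambda>i. avg (K i) f)"
    unfolding swap[symmetric] avg_def
    by (simp flip: scaleR_scaleR add: infsum_scaleR_right)
  finally show ?thesis .
qed

lemma avg_map:
  fixes f :: "'a \<Rightarrow> 'k::{real_normed_vector, banach}"
  assumes "\<And>x. norm (f x) \<le> B"
  shows "avg (map_pmf g M) f = avg M (\<lambda>x. f (g x))"
  unfolding map_pmf_def by (simp add: avg_bind[of f, OF assms] avg_return)

lemma avg_scalar_mult:
  fixes f :: "'a \<Rightarrow> 'k::{real_normed_field, banach}"
  shows "avg M (\<lambda>y. c * f y) = c * avg M f"
proof -
  have "pmf M y *\<^sub>R (c * f y) = c * (pmf M y *\<^sub>R f y)" for y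
    by (rule mult_scaleR_right[symmetric])
  then show ?thesis
    unfolding avg_def by (simp only: infsum_cmult_right')
qed

lemma norm_avg_diff_le:
  fixes f :: "'a \<Rightarrow> 'k::{real_normed_field, banach}"
  assumes "\<And>x. norm (f x) \<le> B"
  shows "norm (avg M f - avg N f) \<le> (\<Sum>\<^sub>\<infinity>x. \<bar>pmf M x - pmf N x\<bar>) * B"
proof -
  have "avg M f - avg N f = (\<Sum>\<^sub>\<infinity>x. pmf M x *\<^sub>R f x - pmf N x *\<^sub>R f x)"
    unfolding avg_def
    by (rule infsum_diff[symmetric]) (rule avg_summable[of f, OF assms])+
  also have "\<dots> = (\<Sum>\<^sub>\<infinity>x. (pmf M x - pmf N x) *\<^sub>R f x)"
    by (simp add: scaleR_diff_left)
  also have "norm \<dots> \<le> (\<Sum>\<^sub>\<infinity>x. \<bar>pmf M x - pmf N x\<bar>) * B"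
    by (intro abs_summable_scaleR_bounded(2) assms summable_on_diff pmf_summable_on)
  finally show ?thesis .
qed

section \<open>Convolution as the law of a sum of independent elements\<close>

text \<open>
  In the probability monad, associativity of convolution and its compatibility with mixtures become
  monad laws, and Fubini's theorem becomes commutativity of the monad.
\<close>

definition plus_pmf :: "'g::group_add pmf \<Rightarrow> 'g pmf \<Rightarrow> 'g pmf" where
  "plus_pmf M N = bind_pmf M (\<lambda>x. map_pmf (\<lambda>y. x + y) N)"

lemma plus_pmf_commuted: "plus_pmf M N = bind_pmf N (\<lambda>y. map_pmf (\<lambda>x. x + y) M)"
  unfolding plus_pmf_def map_pmf_def by (rule bind_commute_pmf)

lemma avg_plus_pmf:
  fixes f :: "'g::group_add \<Rightarrow> 'k::{real_normed_vector, banach}"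
  assumes "\<And>x. norm (f x) \<le> B"
  shows "avg (plus_pmf M N) f = avg M (\<lambda>x. avg N (\<lambda>y. f (x + y)))"
    and "avg (plus_pmf M N) f = avg N (\<lambda>y. avg M (\<lambda>x. f (x + y)))"
proof -
  show "avg (plus_pmf M N) f = avg M (\<lambda>x. avg N (\<lambda>y. f (x + y)))"
    unfolding plus_pmf_def by (simp add: avg_bind[of f, OF assms] avg_map[of f, OF assms])
  show "avg (plus_pmf M N) f = avg N (\<lambda>y. avg M (\<lambda>x. f (x + y)))"
    unfolding plus_pmf_commuted by (simp add: avg_bind[of f, OF assms] avg_map[of f, OF assms])
qed

lemma conv_pmf: "conv (pmf M) (pmf N) = pmf (plus_pmf M N)"
proof
  fix \<gamma>
  have "pmf (map_pmf (\<lambda>x. x + y) M) \<gamma> = pmf M (\<gamma> - y)" for y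
    using pmf_map_inj'[of "\<lambda>x. x + y" M "\<gamma> - y"] by (simp add: inj_def)
  then show "conv (pmf M) (pmf N) \<gamma> = pmf (plus_pmf M N) \<gamma>"
    by (simp add: conv_def plus_pmf_commuted pmf_bind_avg avg_def)
qed

lemma plus_pmf_assoc: "plus_pmf (plus_pmf L M) N = plus_pmf L (plus_pmf M N)"
  by (simp add: plus_pmf_def map_pmf_def bind_assoc_pmf bind_return_pmf add.assoc)

lemma plus_pmf_bind_left: "plus_pmf (bind_pmf A K) N = bind_pmf A (\<lambda>i. plus_pmf (K i) N)"
  by (simp add: plus_pmf_def bind_assoc_pmf)

lemma plus_pmf_bind_right: "plus_pmf N (bind_pmf A K) = bind_pmf A (\<lambda>i. plus_pmf N (K i))"
  unfolding plus_pmf_commuted by (simp add: bind_assoc_pmf)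

lemma plus_pmf_zero [simp]:
  "plus_pmf M (return_pmf 0) = M" "plus_pmf (return_pmf 0) M = M"
  by (simp_all add: plus_pmf_def bind_return_pmf bind_return_pmf' map_pmf_def)

primrec pow_pmf :: "'g::group_add pmf \<Rightarrow> nat \<Rightarrow> 'g pmf" where
  "pow_pmf P 0 = return_pmf 0"
| "pow_pmf P (Suc n) = plus_pmf (pow_pmf P n) P"

lemma dirac_eq_pmf: "dirac = pmf (return_pmf 0)"
  by (auto simp: dirac_def indicator_def)

lemma conv_power_pmf: "conv_power (pmf P) n = pmf (pow_pmf P n)"
  by (induction n) (simp_all add: conv_pmf dirac_eq_pmf)

lemma plus_pow_pmf: "plus_pmf P (pow_pmf P n) = pow_pmf P (Suc n)"
proof (induction n)
  case (Suc n)
  then show ?case by (simp flip: plus_pmf_assoc)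
qed simp

text \<open>
  The coefficients form the law of the stopping time.
\<close>

lemma convex_powersE:
  assumes "\<mu> \<in> convex_powers P"
  obtains A where "\<mu> = pmf (bind_pmf A (pow_pmf P))"
proof -
  obtain a where \<mu>: "\<mu> = (\<lambda>\<gamma>. \<Sum>\<^sub>\<infinity>i. a i * conv_power (pmf P) i \<gamma>)"
    and a0: "\<And>i. 0 \<le> a i" and a1: "(a has_sum 1) UNIV"
    using assms unfolding convex_powers_def by blast
  from a1 have "a sums 1" by (rule has_sum_imp_sums)
  then have "(\<Sum>i. ennreal (a i)) = 1"
    using a0 by (simp add: suminf_ennreal2 sums_iff)
  then have "(\<integral>\<^sup>+i. ennreal (a i) \<partial>count_space UNIV) = 1"
    by (simp add: nn_integral_count_space_nat)
  then have "pmf (embed_pmf a) i = a i" for i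
    using a0 by (intro pmf_embed_pmf)
  then have "\<mu> = pmf (bind_pmf (embed_pmf a) (pow_pmf P))"
    by (auto simp: \<mu> pmf_bind_avg avg_def conv_power_pmf)
  then show ?thesis by (rule that)
qed

text \<open>
  The group need not be commutative; a mixture of powers of \<open>P\<close> commutes with \<open>P\<close> because each power
  does. This turns invariance on the right into invariance on the left.
\<close>

lemma plus_pmf_mixture_commute:
  "plus_pmf P (bind_pmf A (pow_pmf P)) = plus_pmf (bind_pmf A (pow_pmf P)) P"
  by (simp add: plus_pmf_bind_left plus_pmf_bind_right plus_pow_pmf)

lemma bounded_harmonic_iff_avg:
  "f \<in> bounded_harmonic P \<longleftrightarrow> (\<forall>\<gamma>. avg P (\<lambda>y. f (\<gamma> - y)) = f \<gamma>)"
  by (auto simp: bounded_harmonic_def conv_def avg_def fun_eq_iff)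

text \<open>
  The induction peels off the last step of the walk, since this is the one closest to \<open>\<gamma>\<close> in
  \<open>\<gamma> - (x + y)\<close>.
\<close>

lemma avg_pow_harmonic:
  assumes "f \<in> bounded_harmonic P"
  shows "avg (pow_pmf P n) (\<lambda>y. f (\<gamma> - y)) = f \<gamma>"
proof (induction n arbitrary: \<gamma>)
  case (Suc n)
  have b: "norm (f (\<gamma> - x)) \<le> norm f" for x by (rule norm_bounded)
  have "avg (pow_pmf P (Suc n)) (\<lambda>y. f (\<gamma> - y))
      = avg P (\<lambda>y. avg (pow_pmf P n) (\<lambda>x. f (\<gamma> - y - x)))"
    by (simp add: avg_plus_pmf(2)[of "\<lambda>y. f (\<gamma> - y)", OF b] diff_add_eq_diff_diff_swap)
  also have "\<dots> = f \<gamma>"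
    using assms by (simp add: Suc bounded_harmonic_iff_avg)
  finally show ?case .
qed (simp add: avg_return)

section \<open>Bounded functions on a discrete space\<close>

lemma apply_Bcontfun:
  fixes h :: "'g::discrete_topology \<Rightarrow> 'k::real_normed_vector"
  assumes "\<And>x. norm (h x) \<le> B"
  shows "apply_bcontfun (Bcontfun h) = h"
proof -
  have "h \<in> bcontfun"
    unfolding bcontfun_discrete_iff using assms by (intro boundedI[of _ B]) auto
  then show ?thesis by (rule Bcontfun_inverse)
qed

lemma norm_Bcontfun_le:
  fixes h :: "'g::discrete_topology \<Rightarrow> 'k::real_normed_vector"
  assumes "\<And>x. norm (h x) \<le> B"
  shows "norm (Bcontfun h) \<le> B"
  by (rule norm_bound) (simp add: apply_Bcontfun[of h, OF assms] assms)

lemma measure_functional_pmf: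
  fixes f :: "'g::discrete_topology \<Rightarrow>\<^sub>C 'k::{real_normed_field, banach}"
  shows "measure_functional (pmf M) f = avg M f"
  by (simp add: measure_functional_apply[OF pmf_summable_on] avg_def)

lemma apply_scalar_mult: "apply_bcontfun (scalar_mult c f) = (\<lambda>\<gamma>. c * f \<gamma>)"
  by (rule ext) (rule scalar_mult_apply)

lemma vector_space_scalar_mult: "vector_space scalar_mult"
  by unfold_locales (auto intro!: bcontfun_eqI simp: apply_scalar_mult algebra_simps)

definition point_mass :: "'g::discrete_topology \<Rightarrow> 'g \<Rightarrow>\<^sub>C 'k::real_normed_field" where
  "point_mass x = Bcontfun (\<lambda>y. if y = x then 1 else 0)"

lemma apply_point_mass: "apply_bcontfun (point_mass x) = (\<lambda>y. if y = x then 1 else 0)"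
  unfolding point_mass_def by (rule apply_Bcontfun[of _ 1]) simp

lemma bcontfun_sum_apply: "apply_bcontfun (sum h F) z = (\<Sum>x\<in>F. apply_bcontfun (h x) z)"
  by (induction F rule: infinite_finite_induct) simp_all

text \<open>
  Membership in \<open>c\<^sub>0\<close> from the usual decay at infinity: truncating \<open>f\<close> where it is small gives a
  finitely supported approximation.
\<close>

lemma c0I:
  fixes f :: "'g::discrete_topology \<Rightarrow>\<^sub>C 'k::real_normed_field"
  assumes "\<And>\<epsilon>. \<epsilon> > 0 \<Longrightarrow> finite {y. \<epsilon> \<le> norm (apply_bcontfun f y)}"
  shows "f \<in> c0"
  unfolding c0_def closure_approachable_le
proof (intro allI impI)
  fix \<epsilon> :: real assume \<epsilon>: "\<epsilon> > 0"
  define g where "g = Bcontfun (\<lambda>y. if \<epsilon> \<le> norm (f y) then f y else 0)"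
  have g: "apply_bcontfun g = (\<lambda>y. if \<epsilon> \<le> norm (f y) then f y else 0)"
    unfolding g_def by (rule apply_Bcontfun[of _ "norm f"]) (simp add: norm_bounded)
  have "{y. g y \<noteq> 0} \<subseteq> {y. \<epsilon> \<le> norm (f y)}"
    by (auto simp: g split: if_splits)
  then have "finite {y. g y \<noteq> 0}"
    using assms[OF \<epsilon>] by (rule finite_subset)
  moreover have "dist g f \<le> \<epsilon>"
    unfolding dist_norm using \<epsilon> by (intro norm_bound) (simp add: g)
  ultimately show "\<exists>g\<in>{f. finite {\<gamma>. apply_bcontfun f \<gamma> \<noteq> 0}}. dist g f \<le> \<epsilon>"
    by blast
qed

text \<open>
  A continuous functional on bounded functions need not respect pointwise limits. It commutes with
  this average because the average of a uniformly bounded family converges in norm: the part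
  outside a finite set \<open>F\<close> has norm at most \<open>B\<close> times the mass outside \<open>F\<close>.
\<close>

lemma blinfun_avg:
  fixes T :: "('g::discrete_topology \<Rightarrow>\<^sub>C 'k::{real_normed_vector, banach}) \<Rightarrow>\<^sub>L 'b::{real_normed_vector, banach}"
  assumes G: "\<And>y z. norm (G y z) \<le> B"
  shows "T (Bcontfun (\<lambda>z. avg M (\<lambda>y. G y z))) = avg M (\<lambda>y. T (Bcontfun (G y)))"
proof -
  define S where "S = Bcontfun (\<lambda>z. avg M (\<lambda>y. G y z))"
  have S: "S z = avg M (\<lambda>y. G y z)" for z
    unfolding S_def by (subst apply_Bcontfun[of _ B]) (auto intro: norm_avg_le G)
  have Gy: "apply_bcontfun (Bcontfun (G y)) = G y" for y
    by (rule apply_Bcontfun[OF G])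
  have sum_apply: "apply_bcontfun (\<Sum>y\<in>F. pmf M y *\<^sub>R Bcontfun (G y)) z
      = (\<Sum>y\<in>F. pmf M y *\<^sub>R G y z)" if "finite F" for F z
    using that by (induction F) (simp_all add: Gy)
  \<comment> \<open>The weights truncated to \<open>F\<close> turn the finite sum into an unconditional sum over the same index set
    as the average, so that the difference is again such a sum.\<close>
  have bound: "norm ((\<Sum>y\<in>F. pmf M y *\<^sub>R Bcontfun (G y)) - S) \<le> (1 - sum (pmf M) F) * B"
    if F: "finite F" for F
  proof (rule norm_bound)
    fix z
    let ?q = "\<lambda>y. if y \<in> F then pmf M y else 0"
    have q: "(?q has_sum sum (pmf M) F) UNIV"
      using F by (rule has_sum_restrict_finite)
    have "((\<lambda>y. if y \<in> F then pmf M y *\<^sub>R G y z else 0) has_sum (\<Sum>y\<in>F. pmf M y *\<^sub>R G y z)) UNIV"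
      using F by (rule has_sum_restrict_finite)
    then have qG: "((\<lambda>y. ?q y *\<^sub>R G y z) has_sum (\<Sum>y\<in>F. pmf M y *\<^sub>R G y z)) UNIV"
      by (rule has_sum_cong[THEN iffD1, rotated]) auto
    have sub: "S z - (\<Sum>y\<in>F. pmf M y *\<^sub>R G y z)
        = (\<Sum>\<^sub>\<infinity>y. (pmf M y - ?q y) *\<^sub>R G y z)"
      unfolding S avg_def scaleR_diff_left infsumI[OF qG, symmetric]
      by (rule infsum_diff[symmetric, OF avg_summable[of "\<lambda>y. G y z", OF G] has_sum_imp_summable[OF qG]])
    have "norm (\<Sum>\<^sub>\<infinity>y. (pmf M y - ?q y) *\<^sub>R G y z) \<le> (\<Sum>\<^sub>\<infinity>y. \<bar>pmf M y - ?q y\<bar>) * B"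
      by (rule abs_summable_scaleR_bounded(2)[OF summable_on_diff[OF pmf_summable_on has_sum_imp_summable[OF q]] G])
    also have "(\<Sum>\<^sub>\<infinity>y. \<bar>pmf M y - ?q y\<bar>) = (\<Sum>\<^sub>\<infinity>y. pmf M y - ?q y)"
      by (rule infsum_cong) auto
    also have "\<dots> = 1 - sum (pmf M) F"
      by (simp only: infsum_diff[OF pmf_summable_on has_sum_imp_summable[OF q]] infsumI[OF q] infsum_pmf)
    finally show "norm (apply_bcontfun ((\<Sum>y\<in>F. pmf M y *\<^sub>R Bcontfun (G y)) - S) z)
        \<le> (1 - sum (pmf M) F) * B"
      using sub by (simp add: sum_apply[OF F] norm_minus_commute)
  qed
  have "((\<lambda>F. (\<Sum>y\<in>F. pmf M y *\<^sub>R Bcontfun (G y)) - S) \<longlongrightarrow> 0) (finite_subsets_at_top UNIV)"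
  proof (rule Lim_null_comparison)
    show "\<forall>\<^sub>F F in finite_subsets_at_top UNIV.
        norm ((\<Sum>y\<in>F. pmf M y *\<^sub>R Bcontfun (G y)) - S) \<le> (1 - sum (pmf M) F) * B"
      using bound by (intro eventually_finite_subsets_at_top_weakI)
    have "((\<lambda>F. 1 - sum (pmf M) F) \<longlongrightarrow> 1 - 1) (finite_subsets_at_top UNIV)"
      using has_sum_pmf[of M] unfolding has_sum_def by (intro tendsto_diff tendsto_const)
    then show "((\<lambda>F. (1 - sum (pmf M) F) * B) \<longlongrightarrow> 0) (finite_subsets_at_top UNIV)"
      by (intro tendsto_mult_left_zero) simp
  qed
  then have "((\<lambda>y. pmf M y *\<^sub>R Bcontfun (G y)) has_sum S) UNIV"
    unfolding has_sum_def by (rule LIM_zero_cancel)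
  then have "((\<lambda>y. T (pmf M y *\<^sub>R Bcontfun (G y))) has_sum T S) UNIV"
    by (rule has_sum_bounded_linear[OF blinfun.bounded_linear_right])
  then have "T S = (\<Sum>\<^sub>\<infinity>y. pmf M y *\<^sub>R T (Bcontfun (G y)))"
    by (simp add: infsumI blinfun.scaleR_right)
  then show ?thesis
    by (simp only: S_def avg_def)
qed

lemma conv_op_avg: "conv_op P f \<gamma> = avg P (\<lambda>y. f (\<gamma> - y))"
  by (simp add: conv_op_apply conv_def avg_def)

lemma ker_id_minus_conv_op: "ker (\<lambda>f. f - conv_op P f) = bounded_harmonic P"
  by (auto simp: ker_def bounded_harmonic_def conv_op_apply fun_eq_iff
      simp flip: apply_bcontfun_inject)

section \<open>Weak* accumulation points\<close>

text \<open>
  Closed conditions that hold along the sequence pass to \<open>m\<close>. Allowing an arbitrary continuous \<open>F\<close>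
  covers conditions that involve several values of the functional at once, such as linearity over
  the field of scalars.
\<close>

lemma accumulation_point_in_closed:
  assumes "weak_star_accumulation_point m \<mu>"
    and "continuous_map strong_operator_topology euclidean F" and "closed C"
    and "\<forall>\<^sub>F n in sequentially. F (measure_functional (\<mu> n)) \<in> C"
  shows "F m \<in> C"
proof (rule ccontr)
  assume "F m \<notin> C"
  have "openin strong_operator_topology {x. F x \<in> - C}"
    using openin_continuous_map_preimage[OF assms(2), of "- C"] assms(3)
    by (simp add: strong_operator_topology_topspace open_Compl)
  moreover have "m \<in> {x. F x \<in> - C}"
    using \<open>F m \<notin> C\<close> by simp
  ultimately have "\<exists>\<^sub>F n in sequentially. measure_functional (\<mu> n) \<in> {x. F x \<in> - C}"
    using assms(1)[unfolded weak_star_accumulation_point_def, rule_format, of "{x. F x \<in> - C}"] by simp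
  with assms(4) show False
    by (simp add: frequently_def)
qed

lemma accumulation_point_eq_limit:
  assumes "weak_star_accumulation_point m \<mu>"
    and "(\<lambda>n. measure_functional (\<mu> n) h) \<longlonglongrightarrow> L"
  shows "m h = L"
proof -
  have "dist (m h) L \<le> 0 + e" if "e > 0" for e
  proof -
    have "\<forall>\<^sub>F n in sequentially. measure_functional (\<mu> n) h \<in> cball L e"
      using tendstoD[OF assms(2) that] by eventually_elim (simp add: dist_commute)
    then have "m h \<in> cball L e"
      by (rule accumulation_point_in_closed[OF assms(1) strong_operator_topology_continuous_evaluation closed_cball])
    then show ?thesis by (simp add: dist_commute)
  qed
  then have "dist (m h) L \<le> 0"
    by (rule field_le_epsilon)
  then show ?thesis by simp
qed

text \<open>
  What remains of the sequence of measures after passing to the accumulation point. Both invariance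
  conditions are needed since the group is not assumed commutative: the first yields harmonicity of
  \<open>f * m\<close>, the second invariance of \<open>f * m\<close> under replacing \<open>f\<close> by \<open>f * P\<close>.
\<close>

locale stationary_mean =
  fixes P :: "'g::{group_add, discrete_topology} pmf"
    and m :: "('g \<Rightarrow>\<^sub>C 'k::{real_normed_field, banach}) \<Rightarrow>\<^sub>L 'k"
  assumes norm_mean_le: "norm (m h) \<le> norm h"
    and mean_scalar_mult: "m (scalar_mult c h) = c * m h"
    and right_invariant: "m (Bcontfun (\<lambda>z. avg P (\<lambda>y. h (z + y)))) = m h"
    and left_invariant: "m (Bcontfun (\<lambda>z. avg P (\<lambda>y. h (y + z)))) = m h"
    and mean_harmonic: "f \<in> bounded_harmonic P \<Longrightarrow> m (Bcontfun (\<lambda>y. f (\<gamma> - y))) = f \<gamma>"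

text \<open>
  Each property is read off from the measures \<open>\<mu> n\<close>. Both kinds of invariance follow from the same
  estimate: averaging \<open>h\<close> over an additional step on the right or on the left, and then integrating
  against \<open>\<mu> n\<close>, is integration against \<open>\<mu> n * P\<close> or \<open>P * \<mu> n\<close>, and these measures coincide.
\<close>

lemma stationary_mean_of_accumulation_point:
  fixes P :: "'g::{group_add, discrete_topology} pmf"
    and m :: "('g \<Rightarrow>\<^sub>C 'k::{real_normed_field, banach}) \<Rightarrow>\<^sub>L 'k"
  assumes \<mu>: "\<And>n. \<mu> n \<in> convex_powers P"
    and inv: "approx_invariant P \<mu>"
    and m: "weak_star_accumulation_point m \<mu>"
  shows "stationary_mean P m"
proof -
  have "\<forall>n. \<exists>A. \<mu> n = pmf (bind_pmf A (pow_pmf P))"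
    using \<mu> convex_powersE by blast
  then obtain A where \<mu>_def: "\<mu> n = pmf (bind_pmf (A n) (pow_pmf P))" for n
    by (auto simp: choice_iff)
  define M where "M n = bind_pmf (A n) (pow_pmf P)" for n
  have \<mu>_M: "\<mu> n = pmf (M n)" for n by (simp add: \<mu>_def M_def)
  have comm: "plus_pmf P (M n) = plus_pmf (M n) P" for n
    by (simp add: M_def plus_pmf_mixture_commute)
  have mf: "measure_functional (\<mu> n) h = avg (M n) h" for n and h :: "'g \<Rightarrow>\<^sub>C 'k"
    by (simp add: \<mu>_M measure_functional_pmf)
  have conv_diff: "conv (\<mu> n) (\<lambda>y. dirac y - pmf P y) \<gamma>
      = pmf (M n) \<gamma> - pmf (plus_pmf (M n) P) \<gamma>" for n \<gamma>
  proof -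
    have "conv (\<mu> n) (\<lambda>y. dirac y - pmf P y) \<gamma> = conv (\<mu> n) dirac \<gamma> - conv (\<mu> n) (pmf P) \<gamma>"
      unfolding conv_def dirac_eq_pmf scaleR_diff_left
      by (intro infsum_diff avg_summable[where B = 1]) (simp_all add: \<mu>_M pmf_le_1)
    also have "\<dots> = pmf (M n) \<gamma> - pmf (plus_pmf (M n) P) \<gamma>"
      by (simp add: \<mu>_M dirac_eq_pmf conv_pmf)
    finally show ?thesis .
  qed
  have tendsto: "(\<lambda>n. avg (M n) h - avg (plus_pmf (M n) P) h) \<longlonglongrightarrow> 0" for h :: "'g \<Rightarrow>\<^sub>C 'k"
  proof (rule Lim_null_comparison)
    show "\<forall>\<^sub>F n in sequentially. norm (avg (M n) h - avg (plus_pmf (M n) P) h)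
        \<le> (\<Sum>\<^sub>\<infinity>\<gamma>. \<bar>pmf (M n) \<gamma> - pmf (plus_pmf (M n) P) \<gamma>\<bar>) * norm h"
      by (intro always_eventually allI norm_avg_diff_le norm_bounded)
    show "(\<lambda>n. (\<Sum>\<^sub>\<infinity>\<gamma>. \<bar>pmf (M n) \<gamma> - pmf (plus_pmf (M n) P) \<gamma>\<bar>) * norm h) \<longlonglongrightarrow> 0"
      using inv unfolding approx_invariant_def conv_diff by (rule tendsto_mult_left_zero)
  qed
  have invariant: "m g = m h" if g: "\<And>n. avg (M n) g = avg (plus_pmf (M n) P) h"
    for g h :: "'g \<Rightarrow>\<^sub>C 'k"
  proof -
    have "avg (M n) (h - g) = avg (M n) h - avg (plus_pmf (M n) P) h" for n
      using avg_diff[of h "norm h" g "norm g" "M n"] by (simp add: g norm_bounded)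
    then have "m (h - g) = 0"
      using tendsto[of h] by (intro accumulation_point_eq_limit[OF m]) (simp add: mf)
    then show ?thesis by (simp add: blinfun.diff_right)
  qed
  show ?thesis
  proof
    fix h :: "'g \<Rightarrow>\<^sub>C 'k"
    have "m h \<in> cball 0 (norm h)"
      by (rule accumulation_point_in_closed[OF m strong_operator_topology_continuous_evaluation closed_cball])
        (simp add: mf norm_avg_le norm_bounded)
    then show "norm (m h) \<le> norm h" by simp
  next
    fix c and h :: "'g \<Rightarrow>\<^sub>C 'k"
    have "continuous_map strong_operator_topology euclidean
        (\<lambda>x. blinfun_apply x (scalar_mult c h) - c * blinfun_apply x h)"
    proof (intro continuous_map_diff strong_operator_topology_continuous_evaluation)
      show "continuous_map strong_operator_topology euclidean (\<lambda>x. c * blinfun_apply x h)"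
        using continuous_map_compose[OF strong_operator_topology_continuous_evaluation[of h],
            of euclidean "\<lambda>z. c * z"]
        by (simp add: o_def continuous_on_mult_left)
    qed
    then have "m (scalar_mult c h) - c * m h \<in> {0}"
      by (rule accumulation_point_in_closed[OF m]) (simp_all add: mf apply_scalar_mult avg_scalar_mult)
    then show "m (scalar_mult c h) = c * m h" by simp
  next
    fix h :: "'g \<Rightarrow>\<^sub>C 'k"
    have *: "norm (avg P (\<lambda>y. h (z + y))) \<le> norm h" "norm (avg P (\<lambda>y. h (y + z))) \<le> norm h" for z
      by (auto intro!: norm_avg_le norm_bounded)
    show "m (Bcontfun (\<lambda>z. avg P (\<lambda>y. h (z + y)))) = m h"
      by (rule invariant) (simp add: apply_Bcontfun[OF *(1)] avg_plus_pmf(1)[OF norm_bounded])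
    show "m (Bcontfun (\<lambda>z. avg P (\<lambda>y. h (y + z)))) = m h"
      by (rule invariant)
        (simp add: apply_Bcontfun[OF *(2)] avg_plus_pmf(2)[OF norm_bounded] flip: comm)
  next
    fix f :: "'g \<Rightarrow>\<^sub>C 'k" and \<gamma>
    assume f: "f \<in> bounded_harmonic P"
    have "avg (M n) (\<lambda>y. f (\<gamma> - y)) = f \<gamma>" for n
      unfolding M_def by (simp add: avg_bind[OF norm_bounded] avg_pow_harmonic[OF f] avg_const)
    then show "m (Bcontfun (\<lambda>y. f (\<gamma> - y))) = f \<gamma>"
      by (intro accumulation_point_eq_limit[OF m]) (simp add: mf apply_Bcontfun[OF norm_bounded])
  qed
qed

section \<open>The projection onto the harmonic functions\<close>

lemma conv_mean_add: "conv_mean m (f + g) = conv_mean m f + conv_mean m g"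
proof (rule bcontfun_eqI)
  fix \<gamma>
  have "Bcontfun (\<lambda>y. (f + g) (\<gamma> - y)) = Bcontfun (\<lambda>y. f (\<gamma> - y)) + Bcontfun (\<lambda>y. g (\<gamma> - y))"
    by (rule bcontfun_eqI, simp only: conv_mean_apply(1),
        simp only: plus_bcontfun.rep_eq conv_mean_apply(1))
  then show "conv_mean m (f + g) \<gamma> = (conv_mean m f + conv_mean m g) \<gamma>"
    by (simp only: conv_mean_apply(2) blinfun.add_right plus_bcontfun.rep_eq)
qed

lemma conv_mean_scaleR: "conv_mean m (r *\<^sub>R f) = r *\<^sub>R conv_mean m f"
proof (rule bcontfun_eqI)
  fix \<gamma>
  have "Bcontfun (\<lambda>y. (r *\<^sub>R f) (\<gamma> - y)) = r *\<^sub>R Bcontfun (\<lambda>y. f (\<gamma> - y))"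
    by (rule bcontfun_eqI, simp only: conv_mean_apply(1),
        simp only: scaleR_bcontfun.rep_eq conv_mean_apply(1))
  then show "conv_mean m (r *\<^sub>R f) \<gamma> = (r *\<^sub>R conv_mean m f) \<gamma>"
    by (simp only: conv_mean_apply(2) blinfun.scaleR_right scaleR_bcontfun.rep_eq)
qed

context stationary_mean
begin

lemma norm_conv_mean_le: "norm (conv_mean m f) \<le> norm f"
proof (rule norm_bound)
  fix \<gamma>
  have "norm (m (Bcontfun (\<lambda>y. f (\<gamma> - y)))) \<le> norm (Bcontfun (\<lambda>y. f (\<gamma> - y)))"
    by (rule norm_mean_le)
  also have "\<dots> \<le> norm f"
    by (rule norm_Bcontfun_le) (rule norm_bounded)
  finally show "norm (conv_mean m f \<gamma>) \<le> norm f"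
    by (simp only: conv_mean_apply(2))
qed

lemma bounded_linear_conv_mean: "bounded_linear (conv_mean m)"
  by (rule bounded_linear_intro[of _ 1])
    (simp_all only: conv_mean_add conv_mean_scaleR norm_conv_mean_le mult_1_right)

lemma conv_mean_scalar_mult: "conv_mean m (scalar_mult c f) = scalar_mult c (conv_mean m f)"
proof (rule bcontfun_eqI)
  fix \<gamma>
  have "Bcontfun (\<lambda>y. scalar_mult c f (\<gamma> - y)) = scalar_mult c (Bcontfun (\<lambda>y. f (\<gamma> - y)))"
    by (rule bcontfun_eqI, simp only: conv_mean_apply(1),
        simp only: scalar_mult_apply conv_mean_apply(1))
  then show "conv_mean m (scalar_mult c f) \<gamma> = scalar_mult c (conv_mean m f) \<gamma>"
    by (simp only: conv_mean_apply(2) mean_scalar_mult scalar_mult_apply)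
qed

text \<open>
  By the exchange of \<open>m\<close> with the average, \<open>(f * m) * P\<close> equals \<open>f * (m * P)\<close>, and \<open>m * P = m\<close> by invariance on
  the right. In additive notation the order of the two translations is reversed by
  \<open>\<gamma> - y - z = \<gamma> - (z + y)\<close>.
\<close>

lemma conv_mean_harmonic: "conv_mean m f \<in> bounded_harmonic P"
  unfolding bounded_harmonic_iff_avg
proof
  fix \<gamma>
  let ?h = "Bcontfun (\<lambda>y. f (\<gamma> - y))"
  have "avg P (\<lambda>y. conv_mean m f (\<gamma> - y)) = avg P (\<lambda>y. m (Bcontfun (\<lambda>z. f (\<gamma> - y - z))))"
    by (simp only: conv_mean_apply(2))
  also have "\<dots> = m (Bcontfun (\<lambda>z. avg P (\<lambda>y. f (\<gamma> - y - z))))"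
    by (rule blinfun_avg[symmetric]) (rule norm_bounded)
  also have "\<dots> = m (Bcontfun (\<lambda>z. avg P (\<lambda>y. ?h (z + y))))"
    by (simp only: conv_mean_apply(1) diff_add_eq_diff_diff_swap)
  also have "\<dots> = conv_mean m f \<gamma>"
    by (simp only: right_invariant conv_mean_apply(2))
  finally show "avg P (\<lambda>y. conv_mean m f (\<gamma> - y)) = conv_mean m f \<gamma>" .
qed

text \<open>
  Here \<open>(f * P) * m = f * (P * m)\<close> and \<open>P * m = m\<close> by invariance on the left. The
  average over \<open>P\<close> stays inside \<open>m\<close> throughout.
\<close>

lemma conv_mean_conv_op: "conv_mean m (conv_op P f) = conv_mean m f"
proof (rule bcontfun_eqI)
  fix \<gamma>
  let ?h = "Bcontfun (\<lambda>y. f (\<gamma> - y))"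
  have "conv_mean m (conv_op P f) \<gamma> = m (Bcontfun (\<lambda>z. avg P (\<lambda>y. ?h (y + z))))"
    by (simp only: conv_mean_apply conv_op_avg diff_add_eq_diff_diff_swap)
  also have "\<dots> = conv_mean m f \<gamma>"
    by (simp only: left_invariant conv_mean_apply(2))
  finally show "conv_mean m (conv_op P f) \<gamma> = conv_mean m f \<gamma>" .
qed

lemma conv_mean_fixes_harmonic: "f \<in> bounded_harmonic P \<Longrightarrow> conv_mean m f = f"
  by (rule bcontfun_eqI) (simp only: conv_mean_apply(2) mean_harmonic)

lemma range_conv_mean: "range (conv_mean m) = bounded_harmonic P"
proof
  show "range (conv_mean m) \<subseteq> bounded_harmonic P"
    by (rule image_subsetI) (rule conv_mean_harmonic)
  show "bounded_harmonic P \<subseteq> range (conv_mean m)"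
    by (rule subsetI) (rule range_eqI, rule conv_mean_fixes_harmonic[symmetric])
qed

lemma conv_mean_idem: "conv_mean m (conv_mean m f) = conv_mean m f"
  by (rule conv_mean_fixes_harmonic[OF conv_mean_harmonic])

text \<open>
  The constant function \<open>1\<close> is harmonic; it shows that the norm of the projection is attained.
\<close>

lemma conv_mean_const: "conv_mean m (const_bcontfun 1) = const_bcontfun 1"
  by (rule conv_mean_fixes_harmonic) (simp add: bounded_harmonic_iff_avg avg_const)

lemma onorm_conv_mean: "onorm (conv_mean m) = 1"
proof (rule antisym)
  show "onorm (conv_mean m) \<le> 1"
    by (rule onorm_bound) (simp_all add: norm_conv_mean_le)
  let ?one = "const_bcontfun 1 :: 'g \<Rightarrow>\<^sub>C 'k"
  have "norm ?one \<le> onorm (conv_mean m) * norm ?one"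
    using onorm[OF bounded_linear_conv_mean, of ?one] by (simp add: conv_mean_const)
  moreover have "?one \<noteq> 0"
  proof
    fix z :: 'g
    assume "?one = 0"
    then have "?one z = apply_bcontfun (0 :: 'g \<Rightarrow>\<^sub>C 'k) z"
      by (rule arg_cong)
    then show False by simp
  qed
  ultimately show "1 \<le> onorm (conv_mean m)"
    by simp
qed

lemma linear_conv_mean: "Vector_Spaces.linear scalar_mult scalar_mult (conv_mean m)"
  unfolding Vector_Spaces.linear_iff
  by (intro conjI allI vector_space_scalar_mult conv_mean_add conv_mean_scalar_mult)

lemma conv_mean_diff: "conv_mean m (f - g) = conv_mean m f - conv_mean m g"
  by (rule bounded_linear.linear[OF bounded_linear_conv_mean, THEN linear_diff])

lemma coboundaries_subset_ker: "range (\<lambda>f. f - conv_op P f) \<subseteq> ker (conv_mean m)"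
  by (auto simp: ker_def conv_mean_diff conv_mean_conv_op)

lemma ker_conv_mean: "ker (conv_mean m) = range (\<lambda>f. f - conv_mean m f)"
proof
  show "ker (conv_mean m) \<subseteq> range (\<lambda>f. f - conv_mean m f)"
  proof
    fix f assume "f \<in> ker (conv_mean m)"
    then have "f = f - conv_mean m f" by (simp add: ker_def)
    then show "f \<in> range (\<lambda>f. f - conv_mean m f)" by (rule range_eqI)
  qed
  show "range (\<lambda>f. f - conv_mean m f) \<subseteq> ker (conv_mean m)"
    by (auto simp: ker_def conv_mean_diff conv_mean_idem)
qed

lemma ker_id_minus_conv_mean: "ker (\<lambda>f. f - conv_mean m f) = range (conv_mean m)"
proof
  show "ker (\<lambda>f. f - conv_mean m f) \<subseteq> range (conv_mean m)"
  proof
    fix f assume "f \<in> ker (\<lambda>f. f - conv_mean m f)"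
    then have "f = conv_mean m f" by (simp add: ker_def)
    then show "f \<in> range (conv_mean m)" by (rule range_eqI)
  qed
  show "range (conv_mean m) \<subseteq> ker (\<lambda>f. f - conv_mean m f)"
    by (auto simp: ker_def conv_mean_idem)
qed

end

section \<open>Functions vanishing at infinity\<close>

text \<open>
  An average of values at most \<open>u x\<close> can reach \<open>u x\<close> only if every value of positive weight equals
  \<open>u x\<close>.
\<close>

lemma subharmonic_maximum_propagates:
  fixes u :: "'g::group_add \<Rightarrow> real"
  assumes u: "\<And>y. 0 \<le> u y" "\<And>y. u y \<le> u x"
    and sub: "u x \<le> avg P (\<lambda>y. u (x - y))" and s: "s \<in> set_pmf P"
  shows "u (x - s) = u x"
proof -
  have b: "norm (u (x - y)) \<le> u x" "norm (u x) \<le> u x" for y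
    using u by simp_all
  have "avg P (\<lambda>y. u x - u (x - y)) = u x - avg P (\<lambda>y. u (x - y))"
    by (simp add: avg_diff[of "\<lambda>_. u x" _ "\<lambda>y. u (x - y)", OF b(2) b(1)] avg_const)
  then have le: "(\<Sum>\<^sub>\<infinity>y. pmf P y *\<^sub>R (u x - u (x - y))) \<le> 0"
    using sub by (simp add: avg_def)
  have b3: "norm (u x - u (x - y)) \<le> u x" for y
    using u by simp
  then have "pmf P s *\<^sub>R (u x - u (x - s)) = 0"
    by (intro nonneg_infsum_le_0D[OF le avg_summable[of "\<lambda>y. u x - u (x - y)", OF b3]]) (auto simp: u)
  moreover have "pmf P s \<noteq> 0"
    using s by (simp add: set_pmf_iff)
  ultimately show ?thesis by simp
qed

text \<open>
  On a finite set the injective translations by \<open>S\<close> are permutations, so \<open>S\<close> lies in the stabilizer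
  of \<open>M\<close>. An orbit map embeds the stabilizer into \<open>M\<close>.
\<close>

lemma finite_generated_subgroup:
  fixes S :: "'g::group_add set"
  assumes M: "finite M" "M \<noteq> {}" and S: "\<And>x s. x \<in> M \<Longrightarrow> s \<in> S \<Longrightarrow> x - s \<in> M"
  shows "finite (generated_subgroup S)"
proof -
  define K where "K = {g. \<forall>x. x - g \<in> M \<longleftrightarrow> x \<in> M}"
  have "S \<subseteq> K"
  proof
    fix s assume "s \<in> S"
    then have "(\<lambda>x. x - s) ` M = M"
      using M(1) S by (intro endo_inj_surj inj_onI image_subsetI)
        (simp_all only: diff_conv_add_uminus add_right_cancel)
    then have "x \<in> M" if "x - s \<in> M" for x
    proof -
      have "x - s \<in> (\<lambda>x. x - s) ` M"
        using that \<open>(\<lambda>x. x - s) ` M = M\<close> by simp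
      then obtain x' where "x' \<in> M" "x - s = x' - s"
        by (rule imageE)
      then show "x \<in> M"
        by (simp only: diff_conv_add_uminus add_right_cancel)
    qed
    then show "s \<in> K"
      using S \<open>s \<in> S\<close> unfolding K_def by blast
  qed
  moreover have "is_subgroup K"
    unfolding is_subgroup_def
  proof (intro conjI ballI)
    show "0 \<in> K" by (simp add: K_def)
    show "x + y \<in> K" if "x \<in> K" "y \<in> K" for x y
      using that by (simp only: K_def mem_Collect_eq diff_add_eq_diff_diff_swap) simp
    show "- x \<in> K" if "x \<in> K" for x
      unfolding K_def
    proof (rule CollectI, rule allI)
      fix z
      have "\<forall>z. z - x \<in> M \<longleftrightarrow> z \<in> M"
        using that by (simp add: K_def)
      from this[rule_format, of "z + x"] show "z - - x \<in> M \<longleftrightarrow> z \<in> M"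
        by simp
    qed
  qed
  ultimately have "generated_subgroup S \<subseteq> K"
    unfolding generated_subgroup_def by (rule hull_minimal)
  moreover obtain x where "x \<in> M" using M(2) by blast
  have "(\<lambda>g. x - g) ` K \<subseteq> M"
    using \<open>x \<in> M\<close> unfolding K_def by blast
  then have "finite K"
    using M(1) by (intro inj_on_finite[of "\<lambda>g. x - g" K M] inj_onI)
      (simp only: diff_conv_add_uminus add_left_cancel neg_equal_iff_equal)
  ultimately show ?thesis
    by (rule finite_subset)
qed

context stationary_mean
begin

lemma mean_finite_support:
  fixes h :: "'g \<Rightarrow>\<^sub>C 'k"
  assumes F: "finite F" and h: "\<And>y. y \<notin> F \<Longrightarrow> h y = 0"
  shows "m h = (\<Sum>x\<in>F. h x * m (point_mass x))"
proof -
  have "h = (\<Sum>x\<in>F. scalar_mult (h x) (point_mass x))"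
  proof (rule bcontfun_eqI)
    fix z
    have "(\<Sum>x\<in>F. scalar_mult (h x) (point_mass x) z) = (\<Sum>x\<in>F. if z = x then h x else 0)"
      by (rule sum.cong) (simp_all add: apply_scalar_mult apply_point_mass)
    then show "h z = (\<Sum>x\<in>F. scalar_mult (h x) (point_mass x)) z"
      using F h[of z] by (simp add: bcontfun_sum_apply)
  qed
  then have "m h = m (\<Sum>x\<in>F. scalar_mult (h x) (point_mass x))"
    by (rule arg_cong)
  then show ?thesis
    by (simp add: blinfun.sum_right mean_scalar_mult)
qed

text \<open>
  As a function of \<open>x\<close>, the value of \<open>m\<close> at point masses is therefore harmonic.
\<close>

lemma mean_point_mass: "m (point_mass x) = conv_mean m (point_mass 0) x"
proof -
  have "(point_mass x :: 'g \<Rightarrow>\<^sub>C 'k) = Bcontfun (\<lambda>y. point_mass 0 (x - y))"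
    unfolding point_mass_def[of x] by (rule arg_cong[of _ _ Bcontfun]) (auto simp: apply_point_mass)
  then show ?thesis
    by (simp only: conv_mean_apply(2))
qed

text \<open>
  Rotating the values of \<open>m\<close> at the points of \<open>F\<close> to nonnegative reals produces a test function of
  supremum norm at most one whose mean is the sum of the norms.
\<close>

lemma sum_norm_mean_point_mass_le:
  assumes F: "finite F"
  shows "(\<Sum>x\<in>F. norm (m (point_mass x))) \<le> 1"
proof -
  define c where "c x = (if m (point_mass x) = 0 then 0
    else of_real (norm (m (point_mass x))) / m (point_mass x))" for x
  define h where "h = Bcontfun (\<lambda>x. if x \<in> F then c x else 0)"
  have b: "norm (if x \<in> F then c x else 0) \<le> 1" for x
    by (simp add: c_def norm_divide)
  have h: "apply_bcontfun h = (\<lambda>x. if x \<in> F then c x else 0)"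
    unfolding h_def by (rule apply_Bcontfun[OF b])
  have "m h = (\<Sum>x\<in>F. h x * m (point_mass x))"
    by (rule mean_finite_support[OF F]) (simp add: h)
  also have "\<dots> = (\<Sum>x\<in>F. of_real (norm (m (point_mass x))))"
    by (rule sum.cong) (simp_all add: h c_def)
  also have "\<dots> = of_real (\<Sum>x\<in>F. norm (m (point_mass x)))"
    by simp
  finally have "(\<Sum>x\<in>F. norm (m (point_mass x))) = norm (m h)"
    by (simp add: sum_nonneg del: of_real_sum)
  also have "\<dots> \<le> norm h" by (rule norm_mean_le)
  also have "\<dots> \<le> 1" unfolding h_def by (rule norm_Bcontfun_le[OF b])
  finally show ?thesis .
qed

lemma finite_mean_point_mass_ge:
  assumes "\<epsilon> > 0"
  shows "finite {x. \<epsilon> \<le> norm (m (point_mass x))}"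
proof (rule ccontr)
  assume "infinite {x. \<epsilon> \<le> norm (m (point_mass x))}"
  moreover obtain n where n: "1 < real n * \<epsilon>"
    using reals_Archimedean3[OF assms] by blast
  ultimately obtain F where F: "finite F" "card F = n" "F \<subseteq> {x. \<epsilon> \<le> norm (m (point_mass x))}"
    using infinite_arbitrarily_large[of "{x. \<epsilon> \<le> norm (m (point_mass x))}" n] by auto
  have "real n * \<epsilon> = (\<Sum>x\<in>F. \<epsilon>)"
    using F by simp
  also have "\<dots> \<le> (\<Sum>x\<in>F. norm (m (point_mass x)))"
    using F by (intro sum_mono) auto
  also have "\<dots> \<le> 1"
    by (rule sum_norm_mean_point_mass_le) fact
  finally show False using n by simp
qed

text \<open>
  The norms \<open>u x\<close> of the values at point masses are subharmonic, and by the summability of \<open>u\<close> a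
  positive supremum is attained on a finite set. The maximum principle makes this set stable under
  translation by the support of \<open>P\<close>.
\<close>

lemma mean_point_mass_eq_0:
  assumes "infinite (generated_subgroup (set_pmf P))"
  shows "m (point_mass x) = 0"
proof (rule ccontr)
  define u where "u x = norm (m (point_mass x))" for x
  assume "m (point_mass x) \<noteq> 0"
  then have "u x > 0" by (simp add: u_def)
  then have fin: "finite {y. u x \<le> u y}"
    using finite_mean_point_mass_ge[of "u x"] by (simp add: u_def)
  obtain x0 where x0: "u x \<le> u x0" "\<And>y. u x \<le> u y \<Longrightarrow> u y \<le> u x0"
  proof -
    have "Max (u ` {y. u x \<le> u y}) \<in> u ` {y. u x \<le> u y}"
      using fin by (intro Max_in) auto
    then obtain x0 where "u x \<le> u x0" and "u x0 = Max (u ` {y. u x \<le> u y})"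
      by auto
    then show ?thesis
      using fin by (intro that[of x0]) simp_all
  qed
  have max: "u y \<le> u x0" for y
    using x0(1) x0(2)[of y] by linarith
  have sub: "u z \<le> avg P (\<lambda>y. u (z - y))" for z
  proof -
    let ?\<phi> = "conv_mean m (point_mass 0)"
    have u: "u z = norm (?\<phi> z)" for z
      by (simp add: u_def mean_point_mass)
    have "u z = norm (avg P (\<lambda>y. ?\<phi> (z - y)))"
      using conv_mean_harmonic[of "point_mass 0"] by (simp add: bounded_harmonic_iff_avg u)
    also have "\<dots> \<le> (\<Sum>\<^sub>\<infinity>y. norm (pmf P y *\<^sub>R ?\<phi> (z - y)))"
      unfolding avg_def
      by (rule norm_infsum_bound[OF abs_summable_scaleR_bounded(1)[OF pmf_summable_on norm_bounded]])
    finally show ?thesis by (simp add: avg_def u)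
  qed
  let ?M = "{y. u y = u x0}"
  have "?M \<subseteq> {y. u x \<le> u y}"
    using x0(1) by auto
  then have "finite ?M"
    using fin by (rule finite_subset)
  moreover have "z - s \<in> ?M" if "z \<in> ?M" "s \<in> set_pmf P" for z s
  proof -
    from that(1) have z: "u z = u x0" by simp
    have "0 \<le> u y" "u y \<le> u z" for y
      using max by (simp_all add: u_def z[unfolded u_def])
    then have "u (z - s) = u z"
      using sub that(2) by (rule subharmonic_maximum_propagates)
    with z show ?thesis by simp
  qed
  ultimately have "finite (generated_subgroup (set_pmf P))"
    by (intro finite_generated_subgroup[of ?M]) auto
  with assms show False ..
qed

lemma c0_subset_ker_conv_mean:
  assumes "infinite (generated_subgroup (set_pmf P))"
  shows "c0 \<subseteq> ker (conv_mean m)"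
  unfolding c0_def
proof (rule closure_minimal)
  show "{f. finite {\<gamma>. apply_bcontfun f \<gamma> \<noteq> 0}} \<subseteq> ker (conv_mean m)"
  proof
    fix f :: "'g \<Rightarrow>\<^sub>C 'k" assume "f \<in> {f. finite {\<gamma>. apply_bcontfun f \<gamma> \<noteq> 0}}"
    then have f: "finite {\<gamma>. f \<gamma> \<noteq> 0}" by simp
    have "conv_mean m f \<gamma> = 0" for \<gamma>
    proof -
      have "finite ((\<lambda>y. \<gamma> - y) -` {z. f z \<noteq> 0})"
        using f by (rule finite_vimageI)
          (rule injI, simp only: diff_conv_add_uminus add_left_cancel neg_equal_iff_equal)
      then have "m (Bcontfun (\<lambda>y. f (\<gamma> - y))) = 0"
        by (subst mean_finite_support[of "(\<lambda>y. \<gamma> - y) -` {z. f z \<noteq> 0}"])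
          (simp_all add: conv_mean_apply(1) mean_point_mass_eq_0[OF assms])
      then show ?thesis by (simp only: conv_mean_apply(2))
    qed
    then show "f \<in> ker (conv_mean m)"
      by (simp add: ker_def bcontfun_eqI)
  qed
  have "continuous_on UNIV (conv_mean m)"
    by (rule linear_continuous_on[OF bounded_linear_conv_mean])
  then show "closed (ker (conv_mean m))"
    unfolding ker_def by (simp add: closed_Collect_eq)
qed

end

section \<open>Coboundaries do not exhaust the functions vanishing at infinity\<close>

text \<open>
  The left side is the value at the identity of \<open>f * P\<^sup>0 + \<dots> + f * P\<^sup>n\<^sup>-\<^sup>1\<close>, which telescopes. Each
  average of \<open>g * P\<close> against \<open>P\<^sup>n\<close> is an average of \<open>g\<close> against \<open>P * P\<^sup>n = P\<^sup>n\<^sup>+\<^sup>1\<close>.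
\<close>

lemma sum_avg_pow_coboundary:
  fixes g :: "'g::{group_add, discrete_topology} \<Rightarrow>\<^sub>C 'k::{real_normed_field, banach}"
  assumes f: "f = g - conv_op P g"
  shows "(\<Sum>i<n. avg (pow_pmf P i) (\<lambda>y. f (- y))) = g 0 - avg (pow_pmf P n) (\<lambda>y. g (- y))"
proof (induction n)
  case 0
  then show ?case by (simp add: avg_return)
next
  case (Suc n)
  have b: "norm (g (- y)) \<le> norm g" "norm (conv_op P g (- y)) \<le> norm (conv_op P g)" for y
    by (rule norm_bounded)+
  have "avg (pow_pmf P (Suc n)) (\<lambda>y. g (- y)) = avg (pow_pmf P n) (\<lambda>x. avg P (\<lambda>y. g (- (y + x))))"
    unfolding plus_pow_pmf[symmetric] by (rule avg_plus_pmf(2)[of "\<lambda>y. g (- y)", OF b(1)])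
  also have "\<dots> = avg (pow_pmf P n) (\<lambda>x. conv_op P g (- x))"
    by (simp only: conv_op_avg minus_add diff_conv_add_uminus)
  finally have "avg (pow_pmf P n) (\<lambda>y. f (- y))
      = avg (pow_pmf P n) (\<lambda>y. g (- y)) - avg (pow_pmf P (Suc n)) (\<lambda>y. g (- y))"
    by (simp add: f avg_diff[of "\<lambda>y. g (- y)" _ "\<lambda>y. conv_op P g (- y)", OF b])
  with Suc show ?case by simp
qed

lemma ex_finite_half_mass:
  fixes Q :: "nat \<Rightarrow> 'a pmf"
  shows "\<exists>F. finite F \<and> (\<forall>i<n. 1 / 2 \<le> sum (pmf (Q i)) F)"
proof -
  have "\<exists>F. finite F \<and> 1 / 2 \<le> sum (pmf (Q i)) F" for i
  proof -
    obtain F where "finite F" "\<bar>sum (pmf (Q i)) F - 1\<bar> \<le> 1 / 2"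
      using infsum_finite_approximation[OF pmf_summable_on[of "Q i"], of "1 / 2"]
      by (auto simp: infsum_pmf dist_real_def)
    moreover from this have "1 / 2 \<le> sum (pmf (Q i)) F"
      unfolding abs_le_iff by linarith
    ultimately show ?thesis by blast
  qed
  then have "\<forall>i. \<exists>F. finite F \<and> 1 / 2 \<le> sum (pmf (Q i)) F"
    by (rule allI)
  then obtain F where F: "finite (F i)" "1 / 2 \<le> sum (pmf (Q i)) (F i)" for i
    unfolding choice_iff by blast
  have "1 / 2 \<le> sum (pmf (Q i)) (\<Union>j<n. F j)" if "i < n" for i
    using F(2)[of i] sum_mono2[of "\<Union>j<n. F j" "F i" "pmf (Q i)"] F(1) that by force
  then show ?thesis
    using F(1) by (intro exI[of _ "\<Union>j<n. F j"]) auto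
qed

text \<open>
  The weight of a point is determined by the first of the sets that contains it, so it is at least
  \<open>2\<^sup>-\<^sup>k\<close> on \<open>F k\<close>, and points of weight at least \<open>\<epsilon>\<close> lie in finitely many of the sets.
\<close>

lemma ex_vanishing_weight:
  fixes F :: "nat \<Rightarrow> 'a set"
  assumes F: "\<And>k. finite (F k)"
  obtains w :: "'a \<Rightarrow> real" where "\<And>y. 0 \<le> w y" "\<And>y. w y \<le> 1"
    "\<And>k y. y \<in> F k \<Longrightarrow> (1 / 2) ^ k \<le> w y" "\<And>\<epsilon>. \<epsilon> > 0 \<Longrightarrow> finite {y. \<epsilon> \<le> w y}"
proof
  define w :: "'a \<Rightarrow> real" where
    "w y = (if \<exists>k. y \<in> F k then (1 / 2) ^ (LEAST k. y \<in> F k) else 0)" for y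
  show "0 \<le> w y" "w y \<le> 1" for y
    by (simp_all add: w_def power_le_one)
  show "(1 / 2) ^ k \<le> w y" if "y \<in> F k" for k y
  proof -
    have "(1 / 2) ^ k \<le> (1 / 2 :: real) ^ (LEAST k. y \<in> F k)"
      using that by (intro power_decreasing Least_le) auto
    then show ?thesis using that by (auto simp: w_def)
  qed
  fix \<epsilon> :: real assume "\<epsilon> > 0"
  then obtain n where n: "(1 / 2) ^ n < \<epsilon>"
    using real_arch_pow_inv[of \<epsilon> "1 / 2"] by auto
  have "{y. \<epsilon> \<le> w y} \<subseteq> (\<Union>k<n. F k)"
  proof
    fix y assume "y \<in> {y. \<epsilon> \<le> w y}"
    then have y: "\<epsilon> \<le> w y" by simp
    with \<open>\<epsilon> > 0\<close> have ex: "\<exists>k. y \<in> F k"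
      by (auto simp: w_def split: if_splits)
    define k where "k = (LEAST k. y \<in> F k)"
    have "y \<in> F k"
      unfolding k_def using ex by (rule LeastI_ex)
    moreover have "(1 / 2) ^ n < (1 / 2 :: real) ^ k"
      using y n ex unfolding w_def k_def by (simp only: if_True)
    then have "k < n"
      using power_decreasing[of n k "1 / 2 :: real"] by (intro not_le_imp_less notI) simp
    ultimately show "y \<in> (\<Union>k<n. F k)" by blast
  qed
  then show "finite {y. \<epsilon> \<le> w y}"
    by (rule finite_subset) (simp add: F)
qed

text \<open>
  Let \<open>F k\<close> be a finite set that carries half of the mass of each of the first \<open>4\<^sup>k\<close> powers of \<open>P\<close>, and
  let \<open>f\<close> have weight at least \<open>2\<^sup>-\<^sup>k\<close> on \<open>F k\<close>. The sum of the first \<open>4\<^sup>k\<close> averages of \<open>f\<close> is then at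
  least \<open>2\<^sup>k\<^sup>-\<^sup>1\<close>, whereas for a coboundary these sums are bounded. The number of powers has to
  grow faster than the weight decays; positivity of \<open>f\<close> replaces the uniform boundedness
  principle.
\<close>

lemma c0_not_subset_coboundaries:
  fixes P :: "'g::{group_add, discrete_topology} pmf"
  shows "\<exists>f :: 'g \<Rightarrow>\<^sub>C 'k::{real_normed_field, banach}.
    f \<in> c0 \<and> f \<notin> range (\<lambda>g. g - conv_op P g)"
proof -
  have "\<forall>k::nat. \<exists>F. finite F \<and> (\<forall>i<4 ^ k. 1 / 2 \<le> sum (pmf (pow_pmf P i)) F)"
    by (intro allI ex_finite_half_mass)
  then obtain F where F: "finite (F k)" "\<And>i. i < 4 ^ k \<Longrightarrow> 1 / 2 \<le> sum (pmf (pow_pmf P i)) (F k)"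
    for k :: nat
    unfolding choice_iff by blast
  obtain w :: "'g \<Rightarrow> real" where w: "\<And>y. 0 \<le> w y" "\<And>y. w y \<le> 1"
    "\<And>k y. y \<in> F k \<Longrightarrow> (1 / 2) ^ k \<le> w y" "\<And>\<epsilon>. \<epsilon> > 0 \<Longrightarrow> finite {y. \<epsilon> \<le> w y}"
    by (rule ex_vanishing_weight[of F, OF F(1)]) (rule that)
  have wb: "norm (w y) \<le> 1" for y
    using w(1,2)[of y] by simp
  \<comment> \<open>The reflection cancels the one in \<open>(f * P\<^sup>i)(e) = \<Sum>\<^sub>y f(y\<^sup>-\<^sup>1) P\<^sup>i(y)\<close>.\<close>
  define f :: "'g \<Rightarrow>\<^sub>C 'k" where "f = Bcontfun (\<lambda>y. of_real (w (- y)))"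
  have f: "apply_bcontfun f = (\<lambda>y. of_real (w (- y)))"
    unfolding f_def by (rule apply_Bcontfun[of _ 1]) (use wb in simp)
  have "f \<in> c0"
  proof (rule c0I)
    fix \<epsilon> :: real assume "\<epsilon> > 0"
    then have "finite (uminus -` {y. \<epsilon> \<le> w y})"
      by (intro finite_vimageI w(4)) (auto simp: inj_on_def)
    then show "finite {y. \<epsilon> \<le> norm (f y)}"
      by (simp add: f w(1) vimage_def)
  qed
  moreover have "f \<notin> range (\<lambda>g. g - conv_op P g)"
  proof
    assume "f \<in> range (\<lambda>g. g - conv_op P g)"
    then obtain g where g: "f = g - conv_op P g" by blast
    have lower: "(1 / 2) * (1 / 2) ^ k \<le> avg (pow_pmf P i) w" if "i < 4 ^ k" for i k
    proof -
      have "(1 / 2) * (1 / 2) ^ k \<le> sum (pmf (pow_pmf P i)) (F k) * (1 / 2) ^ k"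
        using F(2)[OF that] by (intro mult_right_mono) auto
      also have "\<dots> \<le> (\<Sum>y\<in>F k. pmf (pow_pmf P i) y *\<^sub>R w y)"
        unfolding sum_distrib_right real_scaleR_def
        by (intro sum_mono mult_left_mono w(3)) auto
      also have "\<dots> \<le> avg (pow_pmf P i) w"
        unfolding avg_def
        by (rule finite_sum_le_infsum[OF avg_summable[of w, OF wb] F(1)]) (auto simp: w(1))
      finally show ?thesis .
    qed
    have "2 ^ k \<le> 4 * norm g" for k :: nat
    proof -
      let ?n = "4 ^ k :: nat"
      have "(4 * (1 / 2)) ^ k = (4 :: real) ^ k * (1 / 2) ^ k"
        by (rule power_mult_distrib)
      then have "2 ^ k / 2 = real ?n * ((1 / 2) * (1 / 2) ^ k)"
        by simp
      also have "\<dots> = (\<Sum>i<?n. (1 / 2) * (1 / 2) ^ k)"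
        by simp
      also have "\<dots> \<le> (\<Sum>i<?n. avg (pow_pmf P i) w)"
        by (intro sum_mono lower) simp
      also have "\<dots> \<le> norm (of_real (\<Sum>i<?n. avg (pow_pmf P i) w) :: 'k)"
        unfolding norm_of_real by (rule abs_ge_self)
      also have "of_real (\<Sum>i<?n. avg (pow_pmf P i) w) = (\<Sum>i<?n. avg (pow_pmf P i) (\<lambda>y. f (- y)))"
        by (simp add: f avg_of_real[of w, OF wb])
      also have "\<dots> = g 0 - avg (pow_pmf P ?n) (\<lambda>y. g (- y))"
        by (rule sum_avg_pow_coboundary[OF g])
      also have "norm \<dots> \<le> norm g + norm g"
        by (intro norm_triangle_le_diff add_mono norm_avg_le norm_bounded)
      finally show ?thesis by simp
    qed
    note upper = this
    obtain k where "4 * norm g < 2 ^ k"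
      using real_arch_pow[of 2 "4 * norm g"] by auto
    with upper[of k] show False by simp
  qed
  ultimately show ?thesis by blast
qed

section \<open>Strict inclusions\<close>

context stationary_mean
begin

lemma coboundaries_psubset_ker:
  assumes "infinite (generated_subgroup (set_pmf P))"
  shows "range (\<lambda>f. f - conv_op P f) \<subset> ker (conv_mean m)"
proof -
  obtain f :: "'g \<Rightarrow>\<^sub>C 'k" where "f \<in> c0" "f \<notin> range (\<lambda>g. g - conv_op P g)"
    using c0_not_subset_coboundaries[of P] by blast
  then have "f \<in> ker (conv_mean m)" "f \<notin> range (\<lambda>g. g - conv_op P g)"
    using c0_subset_ker_conv_mean[OF assms] by auto
  then show ?thesis
    using coboundaries_subset_ker by (intro psubsetI) auto
qed

text \<open>
  The point mass at the identity lies in the kernel of the projection, but its convolution with \<open>P\<close>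
  is \<open>P\<close>.
\<close>

lemma ker_conv_op_psubset_ker:
  assumes "infinite (generated_subgroup (set_pmf P))"
  shows "ker (conv_op P) \<subset> ker (conv_mean m)"
proof (rule psubsetI)
  show "ker (conv_op P) \<subseteq> ker (conv_mean m)"
  proof
    fix f :: "'g \<Rightarrow>\<^sub>C 'k" assume "f \<in> ker (conv_op P)"
    then have "conv_mean m f = conv_mean m 0"
      using conv_mean_conv_op[of f] by (simp add: ker_def)
    then show "f \<in> ker (conv_mean m)"
      by (simp add: ker_def linear_0[OF bounded_linear.linear[OF bounded_linear_conv_mean]])
  qed
  let ?\<delta> = "point_mass 0 :: 'g \<Rightarrow>\<^sub>C 'k"
  have "?\<delta> \<in> ker (conv_mean m)"
    by (simp add: ker_def bcontfun_eqI mean_point_mass_eq_0[OF assms] flip: mean_point_mass)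
  moreover have "?\<delta> \<notin> ker (conv_op P)"
  proof
    obtain s where s: "s \<in> set_pmf P"
      using set_pmf_not_empty[of P] by blast
    have "conv_op P ?\<delta> s = (\<Sum>\<^sub>\<infinity>y\<in>{s}. pmf P y *\<^sub>R ?\<delta> (s - y))"
      unfolding conv_op_avg avg_def
      by (rule infsum_cong_neutral) (auto simp: apply_point_mass)
    then have "conv_op P ?\<delta> s = of_real (pmf P s)"
      by (simp add: apply_point_mass of_real_def)
    moreover assume "?\<delta> \<in> ker (conv_op P)"
    ultimately show False
      using s by (simp add: ker_def set_pmf_iff)
  qed
  ultimately show "ker (conv_op P) \<noteq> ker (conv_mean m)"
    by blast
qed

end

theorem proposition2p2:
  fixes P :: "'g::{group_add, countable, discrete_topology} pmf"
    and \<mu> :: "nat \<Rightarrow> 'g \<Rightarrow> real"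
    and m :: "('g \<Rightarrow>\<^sub>C 'k::{real_normed_field, banach}) \<Rightarrow>\<^sub>L 'k"
    and \<pi> Q :: "('g \<Rightarrow>\<^sub>C 'k) \<Rightarrow> ('g \<Rightarrow>\<^sub>C 'k)"
  assumes "\<And>n. \<mu> n \<in> convex_powers P"
    and "approx_invariant P \<mu>"
    and "weak_star_accumulation_point m \<mu>"
    and "\<pi> = conv_mean m"
    and "Q = conv_op P"
  shows "(bounded_linear \<pi> \<and> Vector_Spaces.linear scalar_mult scalar_mult \<pi> \<and> onorm \<pi> = 1
        \<and> \<pi> \<circ> \<pi> = \<pi> \<and> range \<pi> = bounded_harmonic P)
    \<and> (ker (\<lambda>f. f - \<pi> f) = range \<pi> \<and> range \<pi> = ker (\<lambda>f. f - Q f))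
    \<and> (range (\<lambda>f. f - Q f) \<subseteq> ker \<pi> \<and> ker \<pi> = range (\<lambda>f. f - \<pi> f)
        \<and> (infinite (generated_subgroup (set_pmf P)) \<longrightarrow> range (\<lambda>f. f - Q f) \<subset> ker \<pi>))
    \<and> (infinite (generated_subgroup (set_pmf P)) \<longrightarrow> c0 \<subseteq> ker \<pi> \<and> ker Q \<subset> ker \<pi>)"
proof -
  interpret stationary_mean P m
    using assms(1-3) by (rule stationary_mean_of_accumulation_point)
  show ?thesis
    unfolding assms(4,5)
    by (intro conjI impI bounded_linear_conv_mean linear_conv_mean onorm_conv_mean range_conv_mean
        coboundaries_subset_ker coboundaries_psubset_ker ker_conv_mean ker_id_minus_conv_mean
        c0_subset_ker_conv_mean ker_conv_op_psubset_ker)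
      (simp_all add: fun_eq_iff conv_mean_idem range_conv_mean ker_id_minus_conv_op)
qed

end
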